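(* Let $T:\mathscr{H}\to\mathscr{K}$ be a nonzero linear map and let $c\in(-1,1)$. Then the following statements are equivalent: (i) for all $x,y\in\mathscr{H}$, $x\,\angle_c\,y$ implies $Tx\,\angle_c\,Ty$; (ii) there exists $\gamma>0$ such that $\|Tx\|=\gamma\|x\|$ for all $x\in\mathscr{H}$.
   Context: $\mathscr{H},\mathscr{K}$ are real Hilbert spaces, each of dimension at least $2$ (possibly infinite). For $c\in(-1,1)$ and vectors $x,y$ in a real Hilbert space, $x\,\angle_c\,y$ means $\langle x,y\rangle=c\,\|x\|\,\|y\|$. The linear map $T$ is not assumed to be bounded. *)

theory Defs
  imports "HOL-Analysis.Analysis"
begin

definition angle_rel :: "'a::real_inner \<Rightarrow> real \<Rightarrow> 'a \<Rightarrow> bool"  ("(_ \<angle>\<^bsub>_\<^esub> _)" [51, 0, 51] 50)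
  where "x \<angle>\<^bsub>c\<^esub> y \<longleftrightarrow> x \<bullet> y = c * norm x * norm y"

(* The library's dim is nat-valued and equals 0 on infinite-dimensional spaces, so
   "dim UNIV \<ge> n" would wrongly exclude those; here they satisfy the condition for every n. *)
definition dim_at_least :: "nat \<Rightarrow> 'a::real_vector itself \<Rightarrow> bool"
  where "dim_at_least n _ \<longleftrightarrow>
    (\<exists>B::'a set. independent B \<and> span B = UNIV \<and> (infinite B \<or> n \<le> card B))"

end

theory Submission
  imports Defs
begin

text \<open>
  The substance lies in deriving the similarity property from preservation of a single angle.
  Let \<open>s = sqrt (1 - c\<^sup>2)\<close> and let \<open>x\<close>, \<open>y\<close> be nonzero and orthogonal. The two vectors obtained by
  rotating \<open>x\<close> through the angle \<open>arccos c\<close> towards \<open>y\<close> and towards \<open>- y\<close> are both at angle \<open>c\<close>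
  to \<open>x\<close>. Squaring the two equations for their images and subtracting leaves
  \<open>(1 - c\<^sup>2) * (norm (T x))\<^sup>2 * (T x \<bullet> T y) = 0\<close> up to a nonzero factor, provided \<open>c \<noteq> 0\<close>; hence
  \<open>T x\<close> and \<open>T y\<close> are orthogonal. For \<open>c = 0\<close> this is the assumption itself. So \<open>T\<close> preserves orthogonality
  (lemma \<open>angle_preserving_imp_orthogonality_preserving\<close>).

  Two vectors have equal norm exactly when their sum and difference are orthogonal, so a linear map
  that preserves orthogonality sends vectors of equal norm to vectors of equal norm, which makes
  the ratio \<open>norm (T x) / norm x\<close> constant
  (lemma \<open>orthogonality_preserving_imp_similarity\<close>).

  Conversely, by polarization a linear similarity multiplies all inner products by \<open>\<gamma>\<^sup>2\<close>, so it
  preserves every angle.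
\<close>

text \<open>The scalars \<open>c * norm y\<close> and \<open>s * norm x\<close> are chosen so that, up to the factor \<open>norm y\<close>,
  the second vector is \<open>x\<close> rotated towards \<open>y\<close>; this form stays meaningful when \<open>x\<close> or \<open>y\<close>
  vanishes.\<close>

lemma angle_rel_rotated:
  fixes x y :: "'a::real_inner"
  assumes orth: "x \<bullet> y = 0" and s: "c\<^sup>2 + s\<^sup>2 = 1"
  shows "x \<angle>\<^bsub>c\<^esub> ((c * norm y) *\<^sub>R x + (s * norm x) *\<^sub>R y)"
proof -
  let ?z = "(c * norm y) *\<^sub>R x + (s * norm x) *\<^sub>R y"
  have "(norm ?z)\<^sup>2 = (c\<^sup>2 + s\<^sup>2) * (norm x * norm y)\<^sup>2"
    using orth
    by (simp add: power2_norm_eq_inner inner_add_left inner_add_right inner_commute[of y x])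
      (simp add: dot_square_norm algebra_simps power2_eq_square)
  then have "norm ?z = norm x * norm y"
    using s by (simp add: power2_eq_iff_nonneg)
  moreover have "x \<bullet> ?z = c * norm x * (norm x * norm y)"
    using orth by (simp add: inner_add_right dot_square_norm power2_eq_square)
  ultimately show ?thesis
    by (simp add: angle_rel_def)
qed

lemma angle_rel_combination_squared:
  fixes u v :: "'a::real_inner"
  assumes "u \<angle>\<^bsub>c\<^esub> (\<alpha> *\<^sub>R u + \<beta> *\<^sub>R v)"
  shows "(\<alpha> * (u \<bullet> u) + \<beta> * (u \<bullet> v))\<^sup>2
    = c\<^sup>2 * (u \<bullet> u) * (\<alpha>\<^sup>2 * (u \<bullet> u) + 2 * \<alpha> * \<beta> * (u \<bullet> v) + \<beta>\<^sup>2 * (v \<bullet> v))"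
proof -
  let ?w = "\<alpha> *\<^sub>R u + \<beta> *\<^sub>R v"
  have "(u \<bullet> ?w)\<^sup>2 = c\<^sup>2 * (u \<bullet> u) * (?w \<bullet> ?w)"
    using assms by (simp add: angle_rel_def power_mult_distrib power2_norm_eq_inner)
  moreover have "u \<bullet> ?w = \<alpha> * (u \<bullet> u) + \<beta> * (u \<bullet> v)"
    by (simp add: inner_add_right)
  moreover have "?w \<bullet> ?w = \<alpha>\<^sup>2 * (u \<bullet> u) + 2 * \<alpha> * \<beta> * (u \<bullet> v) + \<beta>\<^sup>2 * (v \<bullet> v)"
    by (simp add: inner_add_left inner_add_right inner_commute[of v u] algebra_simps power2_eq_square)
  ultimately show ?thesis
    by simp
qed

text \<open>In the squared equations for the two angles, the terms even in \<open>\<beta>\<close> agree and cancel on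
  subtraction; the odd ones are all multiples of \<open>(u \<bullet> u) * (u \<bullet> v)\<close>. If \<open>u \<bullet> u\<close> is the factor
  that vanishes, then \<open>u = 0\<close> and the claim is trivial.\<close>

lemma symmetric_angles_imp_orthogonal:
  fixes u v :: "'a::real_inner"
  assumes plus: "u \<angle>\<^bsub>c\<^esub> (\<alpha> *\<^sub>R u + \<beta> *\<^sub>R v)"
    and minus: "u \<angle>\<^bsub>c\<^esub> (\<alpha> *\<^sub>R u + (- \<beta>) *\<^sub>R v)"
    and nz: "\<alpha> \<noteq> 0" "\<beta> \<noteq> 0" and c: "c\<^sup>2 \<noteq> 1"
  shows "u \<bullet> v = 0"
proof -
  have "4 * \<alpha> * \<beta> * (1 - c\<^sup>2) * (u \<bullet> u) * (u \<bullet> v) = 0"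
    using angle_rel_combination_squared[OF plus] angle_rel_combination_squared[OF minus]
    by algebra
  then show ?thesis
    using nz c by auto
qed

lemma angle_preserving_imp_orthogonality_preserving:
  fixes T :: "'a::real_inner \<Rightarrow> 'b::real_inner"
  assumes lin: "linear T"
    and c: "\<bar>c\<bar> < 1"
    and pres: "\<And>x y. x \<angle>\<^bsub>c\<^esub> y \<Longrightarrow> T x \<angle>\<^bsub>c\<^esub> T y"
    and orth: "x \<bullet> y = 0"
  shows "T x \<bullet> T y = 0"
proof (cases "c = 0 \<or> x = 0 \<or> y = 0")
  case True
  then show ?thesis
    using pres[of x y] orth linear_0[OF lin] by (auto simp: angle_rel_def)
next
  case False
  have c2: "c\<^sup>2 < 1"
    using c by (simp add: abs_square_less_1)
  define s where "s = sqrt (1 - c\<^sup>2)"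
  have s: "c\<^sup>2 + s\<^sup>2 = 1" "s \<noteq> 0"
    using c2 by (auto simp: s_def)
  have "T x \<angle>\<^bsub>c\<^esub> ((c * norm y) *\<^sub>R T x + (t * norm x) *\<^sub>R T y)" if "c\<^sup>2 + t\<^sup>2 = 1" for t
    using pres[OF angle_rel_rotated[OF orth that]]
    by (simp add: linear_add[OF lin] linear_scale[OF lin])
  from this[of s] this[of "- s"] show ?thesis
    using s False c2 symmetric_angles_imp_orthogonal[of "T x" c "c * norm y" "s * norm x" "T y"]
    by simp
qed

text \<open>The sum and the difference of two vectors of equal norm are orthogonal, and conversely; hence
  \<open>T\<close> respects equality of norms. The vector \<open>e\<close> outside the kernel supplies the ratio: every \<open>x\<close> is then compared with \<open>norm x *\<^sub>R e\<close>, after scaling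
  \<open>x\<close> by \<open>norm e\<close> to match its norm.\<close>

lemma orthogonality_preserving_imp_similarity:
  fixes T :: "'a::real_inner \<Rightarrow> 'b::real_inner"
  assumes lin: "linear T"
    and orth: "\<And>x y. x \<bullet> y = 0 \<Longrightarrow> T x \<bullet> T y = 0"
    and nz: "T e \<noteq> 0"
  shows "\<exists>\<gamma>>0. \<forall>x. norm (T x) = \<gamma> * norm x"
proof -
  have eq: "norm (T x) = norm (T y)" if "norm x = norm y" for x y
  proof -
    have "(x + y) \<bullet> (x - y) = 0"
      using that by (simp add: norm_eq inner_add_left inner_diff_right inner_commute[of y x])
    then have "(T x + T y) \<bullet> (T x - T y) = 0"
      using orth by (simp flip: linear_add[OF lin] linear_diff[OF lin])
    then show ?thesis
      by (simp add: norm_eq inner_add_left inner_diff_right inner_commute[of "T y" "T x"])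
  qed
  have e: "norm e > 0"
    using nz linear_0[OF lin] by auto
  have "norm (T x) = norm (T e) / norm e * norm x" for x
    using eq[of "norm e *\<^sub>R x" "norm x *\<^sub>R e"] e
    by (simp add: linear_scale[OF lin] field_simps)
  moreover have "norm (T e) / norm e > 0"
    using nz e by simp
  ultimately show ?thesis
    by blast
qed

lemma similarity_inner:
  fixes T :: "'a::real_inner \<Rightarrow> 'b::real_inner"
  assumes lin: "linear T" and sim: "\<And>x. norm (T x) = \<gamma> * norm x"
  shows "T x \<bullet> T y = \<gamma>\<^sup>2 * (x \<bullet> y)"
proof -
  have "T x \<bullet> T y = ((norm (T (x + y)))\<^sup>2 - (norm (T x))\<^sup>2 - (norm (T y))\<^sup>2) / 2"
    by (simp add: linear_add[OF lin] dot_norm)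
  also have "\<dots> = \<gamma>\<^sup>2 * (x \<bullet> y)"
    by (simp add: sim dot_norm power_mult_distrib field_simps)
  finally show ?thesis .
qed

theorem theorem2p4:
  fixes T :: "'h::{real_inner, complete_space} \<Rightarrow> 'k::{real_inner, complete_space}"
    and c :: real
  assumes "dim_at_least 2 TYPE('h)"
    and "dim_at_least 2 TYPE('k)"
    and "linear T"
    and "\<exists>x. T x \<noteq> 0"
    and "c \<in> {-1<..<1}"
  shows "(\<forall>x y. x \<angle>\<^bsub>c\<^esub> y \<longrightarrow> T x \<angle>\<^bsub>c\<^esub> T y)
    \<longleftrightarrow> (\<exists>\<gamma>>0. \<forall>x. norm (T x) = \<gamma> * norm x)"
proof
  assume pres: "\<forall>x y. x \<angle>\<^bsub>c\<^esub> y \<longrightarrow> T x \<angle>\<^bsub>c\<^esub> T y"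
  have c: "\<bar>c\<bar> < 1"
    using assms(5) by auto
  have "T x \<bullet> T y = 0" if "x \<bullet> y = 0" for x y
    using angle_preserving_imp_orthogonality_preserving[OF assms(3) c _ that] pres by blast
  then show "\<exists>\<gamma>>0. \<forall>x. norm (T x) = \<gamma> * norm x"
    using assms(4) orthogonality_preserving_imp_similarity[OF assms(3)] by blast
next
  assume "\<exists>\<gamma>>0. \<forall>x. norm (T x) = \<gamma> * norm x"
  then obtain \<gamma> where sim: "\<And>x. norm (T x) = \<gamma> * norm x"
    by blast
  show "\<forall>x y. x \<angle>\<^bsub>c\<^esub> y \<longrightarrow> T x \<angle>\<^bsub>c\<^esub> T y"
    by (simp add: angle_rel_def similarity_inner[OF assms(3) sim] sim power2_eq_square)
qed

end
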